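(* For every integer $r\ge 0$, \[ \sum_{n=0}^\infty \frac{\binom{2n}{n}\binom{2n+2r}{n+r}}{2^{4n+2r+1}(2n+1)}=\frac{1}{\pi}\int_0^{\pi/2}x\sin^{2r-1}x\,dx. \] *)

theory Defs
  imports "HOL-Analysis.Analysis"
begin

end

theory Submission
  imports Defs
begin

text \<open>
  Substituting \<open>y = sin x\<close> into \<open>arcsin y = (\<Sum>n. c\<^sub>n y^(2n+1))\<close> with
  \<open>c\<^sub>n = (2n choose n) / (4^n (2n+1))\<close> and multiplying by \<open>sin x ^ (2r-1)\<close> gives
  \<open>x sin x ^ (2r-1) = (\<Sum>n. c\<^sub>n sin x ^ (2n+2r))\<close> on the open interval from \<open>0\<close> to \<open>\<pi>/2\<close>.
  All terms are nonnegative and the sum is bounded by \<open>\<pi>/2\<close> (Jordan's inequality), so monotone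
  convergence permits termwise integration, and each term is a Wallis integral.
\<close>

text \<open>Absorption is used twice, with the symmetry of row \<open>2 * n + 1\<close> in between.
  The resulting ratio of consecutive central binomials drives both the binomial series and the
  Wallis recursion.\<close>

lemma Suc_times_central_binomial:
  "Suc n * (2 * Suc n choose Suc n) = 2 * (2 * n + 1) * (2 * n choose n)"
proof -
  have "Suc n * (2 * Suc n choose Suc n) = 2 * (Suc n * (Suc (2 * n) choose n))"
    using Suc_times_binomial[of n "Suc (2 * n)"] by (simp add: algebra_simps)
  also have "Suc (2 * n) choose n = Suc (2 * n) choose Suc n"
    using binomial_symmetric[of n "Suc (2 * n)"] by simp
  also have "Suc n * (Suc (2 * n) choose Suc n) = Suc (2 * n) * (2 * n choose n)"
    by (rule Suc_times_binomial)
  finally show ?thesis by simp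
qed

lemma central_binomial_Suc_real:
  "real (2 * Suc n choose Suc n) = 2 * (2 * real n + 1) / (real n + 1) * real (2 * n choose n)"
proof -
  have "(real n + 1) * real (2 * Suc n choose Suc n) = 2 * (2 * real n + 1) * real (2 * n choose n)"
    using arg_cong[OF Suc_times_central_binomial[of n], of real]
    by (simp only: of_nat_mult of_nat_add of_nat_Suc) (simp add: algebra_simps)
  moreover have "real n + 1 \<noteq> 0" by simp
  ultimately show ?thesis by (simp add: field_simps del: mult_Suc_right binomial_Suc_Suc)
qed

text \<open>Both sides are 1 at \<open>n = 0\<close> and have the same ratio of consecutive terms,
  \<open>(1/2 + n) / (n + 1)\<close>.\<close>

lemma minus_half_gchoose:
  "((-1/2) gchoose n) * (-1) ^ n = real (2 * n choose n) / 4 ^ n"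
proof (induction n)
  case (Suc n)
  \<comment> \<open>With \<open>a = -1/2\<close>, both sides equal
    \<open>a * ((a - 1) gchoose n)\<close>.\<close>
  have "(real n + 1) * ((-1/2::real) gchoose Suc n) = (-1/2 - real n) * ((-1/2) gchoose n)"
    using gbinomial_absorption[of n "-1/2::real"] gbinomial_absorb_comp[of "-1/2::real" n]
    by (simp add: algebra_simps)
  then have rec: "((-1/2::real) gchoose Suc n) = (-1/2 - real n) / (real n + 1) * ((-1/2) gchoose n)"
    by (simp add: field_simps)
  have "((-1/2::real) gchoose Suc n) * (-1) ^ Suc n
      = (1/2 + real n) / (real n + 1) * (((-1/2) gchoose n) * (-1) ^ n)"
    unfolding rec by (simp add: field_simps)
  also have "\<dots> = real (2 * Suc n choose Suc n) / 4 ^ Suc n"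
    unfolding Suc.IH central_binomial_Suc_real by (simp add: divide_simps) (simp add: algebra_simps)
  finally show ?case .
qed simp

text \<open>Newton's binomial series with exponent \<open>-1/2\<close>, evaluated at
  \<open>- t\<^sup>2\<close>.\<close>

lemma inverse_sqrt_series:
  fixes t :: real
  assumes "\<bar>t\<bar> < 1"
  shows "(\<lambda>n. real (2 * n choose n) / 4 ^ n * t ^ (2 * n)) sums inverse (sqrt (1 - t\<^sup>2))"
proof -
  have t: "t\<^sup>2 < 1" using assms by (simp add: abs_square_less_1)
  then have "(\<lambda>n. ((-1/2) gchoose n) * (- t\<^sup>2) ^ n) sums (1 + - t\<^sup>2) powr (-1/2)"
    by (intro gen_binomial_real) simp
  moreover have "((-1/2) gchoose n) * (- t\<^sup>2) ^ n = real (2 * n choose n) / 4 ^ n * t ^ (2 * n)" for n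
    unfolding minus_half_gchoose[symmetric] power_minus[of "t\<^sup>2"] by (simp add: power_mult)
  moreover have "(1 + - t\<^sup>2) powr (-1/2) = inverse (sqrt (1 - t\<^sup>2))"
    using t by (simp add: powr_minus powr_half_sqrt)
  ultimately show ?thesis by simp
qed

text \<open>Monotone convergence for the partial sums: they increase because the terms are
  nonnegative, and the integrable majorant \<open>h\<close> keeps their integrals bounded.\<close>

lemma sums_integral_nonneg:
  fixes f :: "nat \<Rightarrow> 'a::euclidean_space \<Rightarrow> real"
  assumes f: "\<And>n. (f n has_integral I n) S"
    and nonneg: "\<And>n x. x \<in> S \<Longrightarrow> 0 \<le> f n x"
    and sums: "\<And>x. x \<in> S \<Longrightarrow> (\<lambda>n. f n x) sums g x"
    and bound: "\<And>x. x \<in> S \<Longrightarrow> g x \<le> h x" and h: "h integrable_on S"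
  shows "g integrable_on S \<and> I sums integral S g"
proof -
  have partial: "((\<lambda>x. \<Sum>n<k. f n x) has_integral (\<Sum>n<k. I n)) S" for k
    by (intro has_integral_sum f) auto
  have "(\<Sum>n<k. f n x) \<le> h x" if "x \<in> S" for k x
    using sum_le_suminf[OF sums_summable[OF sums[OF that]], of "{..<k}"]
      sums_unique[OF sums[OF that]] nonneg[OF that] bound[OF that] by simp
  then have "(\<Sum>n<k. I n) \<le> integral S h" for k
    using has_integral_le[OF partial integrable_integral[OF h]] by blast
  moreover have "0 \<le> (\<Sum>n<k. I n)" for k
    using partial by (rule has_integral_nonneg) (auto intro: sum_nonneg nonneg)
  ultimately have "bounded (range (\<lambda>k. \<Sum>n<k. I n))"
    by (intro boundedI[of _ "integral S h"]) auto
  then show ?thesis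
    using monotone_convergence_increasing[of "\<lambda>k x. \<Sum>n<k. f n x" S g]
      partial sums nonneg by (auto simp: integral_unique[OF partial] sums_def has_integral_integrable)
qed

text \<open>The series for the derivative of \<open>arcsin\<close> is integrated termwise over
  \<open>{0..y}\<close>. Since \<open>y < 1\<close>, the derivative is integrable there and serves
  as its own majorant.\<close>

lemma arcsin_series:
  fixes y :: real
  assumes "0 \<le> y" "y < 1"
  shows "(\<lambda>n. real (2 * n choose n) / (4 ^ n * (2 * real n + 1)) * y ^ (2 * n + 1)) sums arcsin y"
proof -
  let ?g = "\<lambda>t::real. inverse (sqrt (1 - t\<^sup>2))"
  have g: "(?g has_integral arcsin y) {0..y}"
  proof -
    have "(?g has_integral (arcsin y - arcsin 0)) {0..y}"
      using assms by (intro fundamental_theorem_of_calculus)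
        (auto simp flip: has_real_derivative_iff_has_vector_derivative
          intro!: DERIV_subset[OF DERIV_arcsin])
    then show ?thesis by simp
  qed
  have term_integral: "((\<lambda>t. real (2 * n choose n) / 4 ^ n * t ^ (2 * n)) has_integral
      real (2 * n choose n) / (4 ^ n * (2 * real n + 1)) * y ^ (2 * n + 1)) {0..y}" for n
  proof -
    have "((\<lambda>t. t ^ (2 * n + 1) / (2 * real n + 1)) has_real_derivative t ^ (2 * n)) (at t within S)"
      for t :: real and S
      using DERIV_cdivide[OF DERIV_pow[of "2 * n + 1" t S], of "2 * real n + 1"] by (simp add: add_ac)
    then have "((\<lambda>t. t ^ (2 * n)) has_integral
        (y ^ (2 * n + 1) / (2 * real n + 1) - 0 ^ (2 * n + 1) / (2 * real n + 1))) {0..y}"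
      using assms by (intro fundamental_theorem_of_calculus)
        (auto simp flip: has_real_derivative_iff_has_vector_derivative)
    from has_integral_mult_right[OF this, of "real (2 * n choose n) / 4 ^ n"]
    show ?thesis by simp
  qed
  have "(\<lambda>n. real (2 * n choose n) / (4 ^ n * (2 * real n + 1)) * y ^ (2 * n + 1))
      sums integral {0..y} ?g"
    using sums_integral_nonneg[OF term_integral, where g = ?g and h = ?g]
      inverse_sqrt_series assms has_integral_integrable[OF g] by auto
  then show ?thesis using integral_unique[OF g] by simp
qed

text \<open>Wallis recursion: integrating the derivative of
  \<open>- cos x * sin x ^ (2 * m + 1)\<close> relates the integrals for \<open>m\<close> and
  \<open>Suc m\<close>.\<close>

lemma has_integral_sin_even_power:
  "((\<lambda>x. sin x ^ (2 * m)) has_integral (pi / 2 * real (2 * m choose m) / 4 ^ m)) {0..pi/2}"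
proof (induction m)
  case 0
  show ?case using has_integral_const_real[of "1::real" 0 "pi/2"] by simp
next
  case (Suc m)
  let ?F = "\<lambda>x::real. - cos x * sin x ^ (2 * m + 1)"
  let ?f = "\<lambda>x::real. (2 * real m + 2) * sin x ^ (2 * Suc m) - (2 * real m + 1) * sin x ^ (2 * m)"
  have deriv: "(?F has_real_derivative ?f x) (at x within S)" for x S
  proof -
    have "(?F has_real_derivative
        sin x * sin x ^ (2 * m + 1) - cos x * ((2 * real m + 1) * (sin x ^ (2 * m) * cos x))) (at x within S)"
    proof -
      have "((\<lambda>x. sin x ^ (2 * m + 1)) has_real_derivative
          (2 * real m + 1) * (sin x ^ (2 * m) * cos x)) (at x within S)"
        using DERIV_power[OF DERIV_sin, of "2 * m + 1" x]
        by (auto intro: DERIV_subset simp: add_ac mult_ac)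
      from DERIV_mult[OF DERIV_minus[OF DERIV_subset[OF DERIV_cos subset_UNIV]] this]
      show ?thesis by (simp add: algebra_simps)
    qed
    moreover have "sin x * sin x ^ (2 * m + 1) - cos x * ((2 * real m + 1) * (sin x ^ (2 * m) * cos x))
        = sin x ^ (2 * Suc m) - (2 * real m + 1) * sin x ^ (2 * m) * (cos x)\<^sup>2"
      by (simp add: power2_eq_square mult_ac)
    moreover have "\<dots> = ?f x"
      unfolding cos_squared_eq by (simp add: algebra_simps power2_eq_square)
    ultimately show ?thesis by (simp only:)
  qed
  \<comment> \<open>Both boundary values vanish: \<open>cos (pi/2) = 0\<close>, and
    \<open>sin 0\<close> occurs to a positive power even when \<open>m = 0\<close>.\<close>
  have "(?f has_integral (?F (pi/2) - ?F 0)) {0..pi/2}"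
    using deriv by (intro fundamental_theorem_of_calculus)
      (auto simp flip: has_real_derivative_iff_has_vector_derivative)
  then have "(?f has_integral 0) {0..pi/2}" by simp
  from has_integral_add[OF this has_integral_mult_right[OF Suc.IH, of "2 * real m + 1"]]
  have "((\<lambda>x. (2 * real m + 2) * sin x ^ (2 * Suc m)) has_integral
      ((2 * real m + 1) * (pi / 2 * real (2 * m choose m) / 4 ^ m))) {0..pi/2}"
    by simp
  from has_integral_mult_right[OF this, of "1 / (2 * real m + 2)"]
  have "((\<lambda>x. sin x ^ (2 * Suc m)) has_integral
      (1 / (2 * real m + 2) * ((2 * real m + 1) * (pi / 2 * real (2 * m choose m) / 4 ^ m)))) {0..pi/2}"
    by (simp add: mult.assoc[symmetric] del: mult_Suc_right power_Suc)
  moreover have "1 / (2 * real m + 2) * ((2 * real m + 1) * (pi / 2 * real (2 * m choose m) / 4 ^ m))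
      = pi / 2 * real (2 * Suc m choose Suc m) / 4 ^ Suc m"
    unfolding central_binomial_Suc_real by (simp add: divide_simps)
  ultimately show ?case by simp
qed

text \<open>By concavity the sine lies above its chord from the origin to
  \<open>(pi/2, 1)\<close>.\<close>

lemma Jordan_inequality:
  fixes x :: real
  assumes "0 \<le> x" "x \<le> pi / 2"
  shows "2 / pi * x \<le> sin x"
proof -
  have "concave_on {0..pi/2} (sin :: real \<Rightarrow> real)"
    by (rule f''_le0_imp_concave[where f' = cos and f'' = "\<lambda>x. - sin x"])
      (auto intro!: derivative_eq_intros sin_ge_zero)
  from concave_onD_Icc'[OF this, of x] assms show ?thesis by simp
qed

theorem theorem13:
  fixes r :: nat
  shows "(\<lambda>x::real. x * sin x powi (2 * int r - 1)) integrable_on {0..pi/2} \<and>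
    (\<lambda>n::nat. real ((2*n) choose n) * real ((2*n + 2*r) choose (n + r))
        / (2 ^ (4*n + 2*r + 1) * (2 * real n + 1)))
      sums (1 / pi * integral {0..pi/2} (\<lambda>x::real. x * sin x powi (2 * int r - 1)))"
proof -
  let ?g = "\<lambda>x::real. x * sin x powi (2 * int r - 1)"
  let ?a = "\<lambda>n::nat. real ((2*n) choose n) * real ((2*n + 2*r) choose (n + r))
        / (2 ^ (4*n + 2*r + 1) * (2 * real n + 1))"
  let ?c = "\<lambda>n. real (2 * n choose n) / (4 ^ n * (2 * real n + 1))"
  \<comment> \<open>The open interval matters: for \<open>r = 0\<close> the series has value 1 at
    \<open>x = 0\<close>, where \<open>?g\<close> is 0, and at \<open>pi/2\<close> the sine reaches
    1, outside the range of \<open>arcsin_series\<close>.\<close>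
  have term_integral: "((\<lambda>x. ?c n * sin x ^ (2 * (n + r))) has_integral pi * ?a n) {0<..<pi/2}" for n
  proof -
    \<comment> \<open>The three factors come from \<open>pi / 2\<close>, from \<open>?c n\<close>
      and from the Wallis integral.\<close>
    have "(2::real) ^ (4 * n + 2 * r + 1) = 2 * 4 ^ n * 4 ^ (n + r)"
    proof -
      have "(4::real) ^ k = 2 ^ (2 * k)" for k by (simp add: power_mult)
      then show ?thesis by (simp flip: power_add power_Suc add: algebra_simps)
    qed
    then have "?c n * (pi / 2 * real (2 * (n + r) choose (n + r)) / 4 ^ (n + r)) = pi * ?a n"
      unfolding distrib_left[of "2::nat" n r] by (simp only: times_divide_times_eq times_divide_eq_left times_divide_eq_right divide_divide_eq_left mult_ac)
    then show ?thesis
      using has_integral_mult_right[OF has_integral_sin_even_power[of "n + r"], of "?c n"]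
      by (simp add: has_integral_Icc_iff_Ioo)
  qed
  \<comment> \<open>For \<open>r = 0\<close> the exponent is -1, so \<open>sin x\<close> is split
    off as a denominator. The bound \<open>g_le\<close> then treats the two factors
    separately.\<close>
  have g_eq: "?g x = sin x ^ (2 * r) * (x / sin x)" if "x \<in> {0<..<pi/2}" for x
  proof -
    have "sin x > 0" using that by (simp add: sin_gt_zero)
    then have "sin x powi (2 * int r - 1) = sin x ^ (2 * r) / sin x"
      using power_int_diff[of "sin x" "int (2 * r)" 1] power_int_of_nat[of "sin x" "2 * r"] by simp
    then show ?thesis by simp
  qed
  have g_sums: "(\<lambda>n. ?c n * sin x ^ (2 * (n + r))) sums ?g x" if x: "x \<in> {0<..<pi/2}" for x
  proof -
    have pos: "sin x > 0" using x by (simp add: sin_gt_zero)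
    have "sin x < 1" using x sin_monotone_2pi[of x "pi/2"] by simp
    with pos have "(\<lambda>n. ?c n * sin x ^ (2 * n + 1)) sums x"
      using arcsin_series[of "sin x"] x by (simp add: arcsin_sin)
    \<comment> \<open>This factor raises the exponent \<open>2 * n + 1\<close> to
      \<open>2 * (n + r)\<close>.\<close>
    from sums_mult[OF this, of "sin x ^ (2 * r) / sin x"] show ?thesis
      unfolding g_eq[OF x] using pos by (simp add: power_add distrib_left mult_ac)
  qed
  have g_le: "?g x \<le> pi / 2" if x: "x \<in> {0<..<pi/2}" for x
  proof -
    have pos: "sin x > 0" using x by (simp add: sin_gt_zero)
    then have "sin x ^ (2 * r) \<le> 1" by (simp add: power_le_one)
    moreover have "x / sin x \<le> pi / 2"
      using Jordan_inequality[of x] x pos by (simp add: field_simps)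
    ultimately have "sin x ^ (2 * r) * (x / sin x) \<le> 1 * (pi / 2)"
      using x pos by (intro mult_mono) auto
    then show ?thesis using g_eq[OF x] by simp
  qed
  have "?g integrable_on {0<..<pi/2} \<and> (\<lambda>n. pi * ?a n) sums integral {0<..<pi/2} ?g"
  proof (rule sums_integral_nonneg[OF term_integral _ g_sums g_le])
    show "0 \<le> ?c n * sin x ^ (2 * (n + r))" if "x \<in> {0<..<pi/2}" for n x
      using that by (simp add: sin_ge_zero)
    show "(\<lambda>x. pi / 2) integrable_on {0<..<pi/2}"
      using integrable_on_Icc_iff_Ioo by blast
  qed
  \<comment> \<open>Adding the two endpoints changes neither integrability nor the integral.\<close>
  then have "?g integrable_on {0..pi/2}" and "(\<lambda>n. pi * ?a n) sums integral {0..pi/2} ?g"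
    by (auto simp: integrable_on_Icc_iff_Ioo integral_open_interval_real)
  then show ?thesis using sums_mult[of "\<lambda>n. pi * ?a n" _ "1 / pi"] by simp
qed

end
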